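(* Let $\mathcal G=(\mathcal E,\{m_e\},\{d_i\})$ be any MERA network: a finite connected directed acyclic graph with vertices $i=1,\dots,N$, set $\mathcal E$ of directed edges, integer bond dimensions $m_e\ge 1$ and integer site dimensions $d_i\ge 1$. Then the set $\mathrm{MERA}(\mathcal G)$ of normalized MERA states for $\mathcal G$ is a closed subset of $\mathcal H=\bigotimes_{i=1}^N\mathbb C^{d_i}$.
   Context: MERA stands for multiscale entanglement renormalization ansatz. Each $\mathbb C^{d_i}$ has orthonormal basis $\{|\sigma_i\rangle:\sigma_i=1,\dots,d_i\}$. Closedness is with respect to the norm topology of the finite-dimensional space $\mathcal H$. For a vertex $i$, $\mathrm{in}(i)$ and $\mathrm{out}(i)$ denote its incoming and outgoing edges; put $m_i':=\prod_{e\in\mathrm{in}(i)}m_e$ and $m_i:=\prod_{e\in\mathrm{out}(i)}m_e$ (empty products are $1$). A MERA state for $\mathcal G$ is obtained by assigning to each vertex $i$ a tensor $A_i\in\mathbb C^{d_i\times m_i\times m_i'}$, regarded as a collection of $m_i\times m_i'$ matrices $A_i^{\sigma}$, $\sigma=1,\dots,d_i$ (the row index is the multi-index of bond indices $n_e\in\{1,\dots,m_e\}$ of outgoing edges, the column index the multi-index of those of incoming edges), subject to the isometry constraint $$\sum_{\sigma=1}^{d_i}A_i^\sigma A_i^{\sigma\dagger}=\mathbb 1_{m_i},$$ and contracting all tensors, i.e. the coefficient $\langle\sigma_1,\dots,\sigma_N|\Psi\rangle$ is the sum over all bond indices $n_e$, $e\in\mathcal E$ (each shared by the two endpoints of $e$)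 of the product over $i$ of the corresponding entries of $A_i^{\sigma_i}$. $\mathrm{MERA}(\mathcal G)$ is the set of all such states $|\Psi\rangle\in\mathcal H$ with $\|\Psi\|=1$. *)

theory Defs
  imports "HOL-Analysis.Analysis" "Graph_Theory.Graph_Theory"
begin

locale mera_network = fin_digraph G
  for G :: "(nat, 'e) pre_digraph" (structure) +
  fixes N :: nat and m :: "'e \<Rightarrow> nat" and d :: "nat \<Rightarrow> nat"
  assumes verts_eq: "verts G = {1..N}"
    and connected: "Digraph_Component.connected G"
    and acyclic: "acyclic (arcs_ends G)"
    and bond_dim_ge_1: "\<And>e. e \<in> arcs G \<Longrightarrow> m e \<ge> 1"
    and site_dim_ge_1: "\<And>i. i \<in> verts G \<Longrightarrow> d i \<ge> 1"

text \<open>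
  The product basis of the tensor product of the spaces \<open>\<complex>^{d i}\<close>, \<open>i = 1, \<dots>, N\<close>,
  is labelled by the configurations below, and a vector is represented by its coefficients
  in this orthonormal basis.  Outside the configurations such a coefficient function has the
  conventional value \<^const>\<open>undefined\<close>, so that vectors and coefficient functions
  correspond one to one.
\<close>

definition configs :: "nat \<Rightarrow> (nat \<Rightarrow> nat) \<Rightarrow> (nat \<Rightarrow> nat) set" where
  "configs N d = (\<Pi>\<^sub>E i\<in>{1..N}. {1..d i})"

definition state_space :: "nat \<Rightarrow> (nat \<Rightarrow> nat) \<Rightarrow> ((nat \<Rightarrow> nat) \<Rightarrow> complex) set" where
  "state_space N d = (\<Pi>\<^sub>E \<sigma>\<in>configs N d. UNIV)"

definition state_norm :: "nat \<Rightarrow> (nat \<Rightarrow> nat) \<Rightarrow> ((nat \<Rightarrow> nat) \<Rightarrow> complex) \<Rightarrow> real" where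
  "state_norm N d \<psi> = sqrt (\<Sum>\<sigma>\<in>configs N d. (cmod (\<psi> \<sigma>))\<^sup>2)"

definition state_dist ::
  "nat \<Rightarrow> (nat \<Rightarrow> nat) \<Rightarrow> ((nat \<Rightarrow> nat) \<Rightarrow> complex) \<Rightarrow> ((nat \<Rightarrow> nat) \<Rightarrow> complex) \<Rightarrow> real" where
  "state_dist N d \<phi> \<psi> = state_norm N d (\<lambda>\<sigma>. \<phi> \<sigma> - \<psi> \<sigma>)"

definition norm_topology ::
  "nat \<Rightarrow> (nat \<Rightarrow> nat) \<Rightarrow> ((nat \<Rightarrow> nat) \<Rightarrow> complex) topology" where
  "norm_topology N d = Metric_space.mtopology (state_space N d) (state_dist N d)"

lemma finite_configs: "finite (configs N d)"
  by (simp add: configs_def finite_PiE)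

lemma Metric_space_state: "Metric_space (state_space N d) (state_dist N d)"
proof
  fix \<phi> \<psi> \<xi>
  show "0 \<le> state_dist N d \<phi> \<psi>"
    by (simp add: state_dist_def state_norm_def sum_nonneg)
  show "state_dist N d \<phi> \<psi> = state_dist N d \<psi> \<phi>"
    by (simp add: state_dist_def state_norm_def norm_minus_commute)
  assume \<phi>: "\<phi> \<in> state_space N d" and \<psi>: "\<psi> \<in> state_space N d"
  have "state_dist N d \<phi> \<psi> = 0 \<longleftrightarrow> (\<forall>\<sigma>\<in>configs N d. \<phi> \<sigma> = \<psi> \<sigma>)"
    by (simp add: state_dist_def state_norm_def finite_configs sum_nonneg_eq_0_iff)
  also have "\<dots> \<longleftrightarrow> \<phi> = \<psi>"
    using \<phi> \<psi> unfolding state_space_def by (metis PiE_ext)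
  finally show "state_dist N d \<phi> \<psi> = 0 \<longleftrightarrow> \<phi> = \<psi>" .
next
  fix \<phi> \<psi> \<xi>
  have "L2_set (\<lambda>\<sigma>. cmod (\<phi> \<sigma> - \<xi> \<sigma>)) (configs N d)
      \<le> L2_set (\<lambda>\<sigma>. cmod (\<phi> \<sigma> - \<psi> \<sigma>) + cmod (\<psi> \<sigma> - \<xi> \<sigma>)) (configs N d)"
    by (rule L2_set_mono) (use norm_triangle_ineq4 in \<open>auto intro: norm_diff_triangle_le\<close>)
  also have "\<dots> \<le> L2_set (\<lambda>\<sigma>. cmod (\<phi> \<sigma> - \<psi> \<sigma>)) (configs N d)
      + L2_set (\<lambda>\<sigma>. cmod (\<psi> \<sigma> - \<xi> \<sigma>)) (configs N d)"
    by (rule L2_set_triangle_ineq)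
  finally show "state_dist N d \<phi> \<xi> \<le> state_dist N d \<phi> \<psi> + state_dist N d \<psi> \<xi>"
    by (simp add: state_dist_def state_norm_def L2_set_def)
qed

lemma topspace_norm_topology: "topspace (norm_topology N d) = state_space N d"
  unfolding norm_topology_def
  by (rule Metric_space.topspace_mtopology[OF Metric_space_state])

definition bond_indices :: "('e \<Rightarrow> nat) \<Rightarrow> 'e set \<Rightarrow> ('e \<Rightarrow> nat) set" where
  "bond_indices m E = (\<Pi>\<^sub>E e\<in>E. {1..m e})"

lemma card_bond_indices: "finite E \<Longrightarrow> card (bond_indices m E) = (\<Prod>e\<in>E. m e)"
  by (simp add: bond_indices_def card_PiE)

text \<open>
  \<open>A i s r c\<close> is the entry in row \<open>r\<close> and column \<open>c\<close> of the \<open>s\<close>-th matrix of the tensor at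
  vertex \<open>i\<close>: rows are multi-indices of the outgoing and columns multi-indices of the
  incoming edges.
\<close>

type_synonym 'e tensors = "nat \<Rightarrow> nat \<Rightarrow> ('e \<Rightarrow> nat) \<Rightarrow> ('e \<Rightarrow> nat) \<Rightarrow> complex"

definition isometric ::
  "(nat, 'e) pre_digraph \<Rightarrow> ('e \<Rightarrow> nat) \<Rightarrow> (nat \<Rightarrow> nat) \<Rightarrow> 'e tensors \<Rightarrow> bool" where
  "isometric G m d A \<longleftrightarrow>
    (\<forall>i\<in>verts G. \<forall>r\<in>bond_indices m (out_arcs G i). \<forall>r'\<in>bond_indices m (out_arcs G i).
      (\<Sum>s=1..d i. \<Sum>c\<in>bond_indices m (in_arcs G i). A i s r c * cnj (A i s r' c))
        = (if r = r' then 1 else 0))"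

definition contraction ::
  "(nat, 'e) pre_digraph \<Rightarrow> nat \<Rightarrow> ('e \<Rightarrow> nat) \<Rightarrow> (nat \<Rightarrow> nat) \<Rightarrow> 'e tensors
    \<Rightarrow> (nat \<Rightarrow> nat) \<Rightarrow> complex" where
  "contraction G N m d A = (\<lambda>\<sigma>\<in>configs N d.
    \<Sum>n\<in>bond_indices m (arcs G). \<Prod>i=1..N.
      A i (\<sigma> i) (restrict n (out_arcs G i)) (restrict n (in_arcs G i)))"

definition MERA ::
  "(nat, 'e) pre_digraph \<Rightarrow> nat \<Rightarrow> ('e \<Rightarrow> nat) \<Rightarrow> (nat \<Rightarrow> nat)
    \<Rightarrow> ((nat \<Rightarrow> nat) \<Rightarrow> complex) set" where
  "MERA G N m d = {\<psi> \<in> state_space N d.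
    (\<exists>A. isometric G m d A \<and> \<psi> = contraction G N m d A) \<and> state_norm N d \<psi> = 1}"

end

theory Submission
  imports Defs
begin

text \<open>
  The isometry constraint bounds every tensor entry by \<open>1\<close> in modulus, so the admissible tensors
  whose contraction is normalized form a compact set.  The contraction is polynomial in the entries,
  hence continuous, so its image is compact and therefore closed.
\<close>

text \<open>
  Tensors are uncurried so that the topology of pointwise convergence and Tychonoff's theorem
  apply to them directly.
\<close>

definition curry_tensors ::
  "(nat \<times> nat \<times> ('e \<Rightarrow> nat) \<times> ('e \<Rightarrow> nat) \<Rightarrow> complex) \<Rightarrow> 'e tensors" where
  "curry_tensors B = (\<lambda>i s r c. B (i, s, r, c))"

lemma continuous_on_curry_tensors:
  "continuous_on S (\<lambda>B. curry_tensors B i s r c)"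
  unfolding curry_tensors_def
  by (rule continuous_on_subset[OF continuous_on_product_coordinates]) auto

text \<open>At a configuration the coefficient is a sum of products of coordinates of
  \<open>B\<close>; at any other \<sigma> it is the constant \<open>undefined\<close>.\<close>

lemma continuous_on_contraction:
  "continuous_on S (\<lambda>B. contraction G N m d (curry_tensors B) \<sigma>)"
  by (cases "\<sigma> \<in> configs N d")
    (auto simp: contraction_def intro!: continuous_intros continuous_on_curry_tensors)

lemma continuous_map_contraction:
  "continuous_map euclidean (norm_topology N d) (\<lambda>B. contraction G N m d (curry_tensors B))"
  unfolding norm_topology_def Metric_space.continuous_map_to_metric[OF Metric_space_state]
proof (intro ballI allI impI)
  fix B :: "nat \<times> nat \<times> ('a \<Rightarrow> nat) \<times> ('a \<Rightarrow> nat) \<Rightarrow> complex" and \<epsilon> :: real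
  assume "\<epsilon> > 0"
  let ?f = "\<lambda>B. contraction G N m d (curry_tensors B)"
  \<comment> \<open>The preimage of the \<epsilon>-ball around \<open>?f B\<close>. It is open
    because the distance to the fixed state \<open>?f B\<close> is built from the coefficients, each
    continuous in \<open>B'\<close>.\<close>
  let ?U = "{B'. state_dist N d (?f B) (?f B') < \<epsilon>}"
  have space: "?f B' \<in> state_space N d" for B'
    by (simp add: state_space_def contraction_def)
  have "open ?U"
    unfolding state_dist_def state_norm_def
    by (intro open_Collect_less continuous_intros continuous_on_contraction)
  moreover have "B \<in> ?U"
    using \<open>\<epsilon> > 0\<close> Metric_space.mdist_zero[OF Metric_space_state space, of B] by simp
  moreover have "?f B' \<in> Metric_space.mball (state_space N d) (state_dist N d) (?f B) \<epsilon>"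
    if "B' \<in> ?U" for B'
    using that space by (simp add: Metric_space.in_mball[OF Metric_space_state])
  ultimately show "\<exists>U. openin euclidean U \<and> B \<in> U \<and>
      (\<forall>B'\<in>U. ?f B' \<in> Metric_space.mball (state_space N d) (state_dist N d) (?f B) \<epsilon>)"
    by (intro exI[of _ ?U]) auto
qed

text \<open>An intersection of solution sets of equations between continuous functions of
  \<open>B\<close>; the index ranges do not depend on \<open>B\<close>.\<close>

lemma closed_isometric: "closed {B. isometric G m d (curry_tensors B)}"
  unfolding isometric_def Ball_def
  by (intro closed_Collect_all closed_Collect_imp open_Collect_const closed_Collect_eq
      continuous_intros continuous_on_curry_tensors)

lemma closed_contraction_normalized:
  "closed {B. state_norm N d (contraction G N m d (curry_tensors B)) = 1}"
  unfolding state_norm_def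
  by (intro closed_Collect_eq continuous_intros continuous_on_contraction)

text \<open>Tychonoff: a product of closed unit discs. The index type may be infinite, so
  compactness refers to pointwise convergence.\<close>

lemma compact_Pi_cball: "compact {B :: 'a \<Rightarrow> complex. \<forall>x. B x \<in> cball 0 1}"
proof -
  have "compactin (product_topology (\<lambda>_. euclidean) UNIV) (\<Pi>\<^sub>E x\<in>(UNIV::'a set). cball (0::complex) 1)"
    by (simp add: compactin_PiE)
  then show ?thesis
    by (simp add: euclidean_product_topology PiE_UNIV_domain Pi_def)
qed

lemma isometric_norm_entry_le_1:
  assumes A: "isometric G m d A" and i: "i \<in> verts G" and s: "s \<in> {1..d i}"
    and r: "r \<in> bond_indices m (out_arcs G i)" and c: "c \<in> bond_indices m (in_arcs G i)"
    and fin: "finite (bond_indices m (in_arcs G i))"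
  shows "norm (A i s r c) \<le> 1"
proof -
  let ?C = "bond_indices m (in_arcs G i)"
  \<comment> \<open>The diagonal case \<open>r' = r\<close> of the constraint: the squared moduli
    along row \<open>r\<close>, over all \<open>s\<close> and \<open>c\<close>, add up to 1, so none
    of them exceeds 1.\<close>
  have "complex_of_real (\<Sum>s=1..d i. \<Sum>c\<in>?C. (norm (A i s r c))\<^sup>2) = 1"
    using A i r unfolding isometric_def by (simp add: complex_norm_square del: of_real_power)
  then have total: "(\<Sum>s=1..d i. \<Sum>c\<in>?C. (norm (A i s r c))\<^sup>2) = 1"
    by (metis of_real_eq_1_iff)
  have "(norm (A i s r c))\<^sup>2 \<le> (\<Sum>c\<in>?C. (norm (A i s r c))\<^sup>2)"
    by (rule member_le_sum) (use c fin in auto)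
  also have "\<dots> \<le> (\<Sum>s=1..d i. \<Sum>c\<in>?C. (norm (A i s r c))\<^sup>2)"
    by (rule member_le_sum[where f = "\<lambda>s. \<Sum>c\<in>?C. (norm (A i s r c))\<^sup>2"])
      (use s in \<open>auto intro: sum_nonneg\<close>)
  finally show ?thesis
    using total by (simp add: power2_le_iff_abs_le abs_square_le_1)
qed

lemma restrict_bond_indices:
  "n \<in> bond_indices m E \<Longrightarrow> F \<subseteq> E \<Longrightarrow> restrict n F \<in> bond_indices m F"
  unfolding bond_indices_def by auto

text \<open>Restrictions of a bond configuration stay within the index ranges of each vertex, so
  entries elsewhere can be reset without changing the state.\<close>

lemma contraction_cong:
  assumes "verts G = {1..N}"
    and "\<And>i s r c. \<lbrakk>i \<in> verts G; s \<in> {1..d i}; r \<in> bond_indices m (out_arcs G i);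
      c \<in> bond_indices m (in_arcs G i)\<rbrakk> \<Longrightarrow> A i s r c = B i s r c"
  shows "contraction G N m d A = contraction G N m d B"
  unfolding contraction_def
proof (intro restrict_ext sum.cong prod.cong refl)
  fix \<sigma> n i
  assume "\<sigma> \<in> configs N d" "n \<in> bond_indices m (arcs G)" "i \<in> {1..N}"
  then show "A i (\<sigma> i) (restrict n (out_arcs G i)) (restrict n (in_arcs G i))
      = B i (\<sigma> i) (restrict n (out_arcs G i)) (restrict n (in_arcs G i))"
    using assms(1)
    by (intro assms(2) restrict_bond_indices[where E = "arcs G"])
      (auto simp: configs_def out_arcs_def in_arcs_def)
qed

lemma isometric_cong:
  assumes "\<And>i s r c. \<lbrakk>i \<in> verts G; s \<in> {1..d i}; r \<in> bond_indices m (out_arcs G i);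
      c \<in> bond_indices m (in_arcs G i)\<rbrakk> \<Longrightarrow> A i s r c = B i s r c"
  shows "isometric G m d A \<longleftrightarrow> isometric G m d B"
  unfolding isometric_def
  by (intro ball_cong refl arg_cong2[where f = "(=)"] sum.cong) (simp_all add: assms)

theorem proposition3:
  fixes G :: "(nat, 'e) pre_digraph" and N :: nat
    and m :: "'e \<Rightarrow> nat" and d :: "nat \<Rightarrow> nat"
  assumes "mera_network G N m d"
  shows "closedin (norm_topology N d) (MERA G N m d)"
proof -
  interpret mera_network G N m d by fact
  let ?f = "\<lambda>B. contraction G N m d (curry_tensors B)"
  \<comment> \<open>The bound is imposed at every index, including those that the isometry
    constraint leaves free; this is what makes \<open>S\<close> compact.\<close>
  define S where "S = {B :: nat \<times> nat \<times> ('e \<Rightarrow> nat) \<times> ('e \<Rightarrow> nat) \<Rightarrow> complex. \<forall>x. B x \<in> cball 0 1}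
    \<inter> ({B. isometric G m d (curry_tensors B)} \<inter> {B. state_norm N d (?f B) = 1})"
  have "compact S"
    unfolding S_def
    by (intro compact_Int_closed compact_Pi_cball closed_Int closed_isometric
        closed_contraction_normalized)
  moreover have "?f ` S = MERA G N m d"
  proof
    show "?f ` S \<subseteq> MERA G N m d"
      by (auto simp: S_def MERA_def state_space_def contraction_def)
    show "MERA G N m d \<subseteq> ?f ` S"
    proof
      fix \<psi> assume "\<psi> \<in> MERA G N m d"
      then obtain A where A: "isometric G m d A" and \<psi>: "\<psi> = contraction G N m d A"
        and norm: "state_norm N d \<psi> = 1"
        by (auto simp: MERA_def)
      \<comment> \<open>The isometry constraint says nothing about entries at meaningless indices.\<close>
      define B where "B = (\<lambda>(i, s, r, c). if i \<in> verts G \<and> s \<in> {1..d i}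
        \<and> r \<in> bond_indices m (out_arcs G i) \<and> c \<in> bond_indices m (in_arcs G i)
        then A i s r c else 0)"
      have eq: "curry_tensors B i s r c = A i s r c"
        if "i \<in> verts G" "s \<in> {1..d i}" "r \<in> bond_indices m (out_arcs G i)"
          "c \<in> bond_indices m (in_arcs G i)" for i s r c
        using that by (simp add: B_def curry_tensors_def)
      have "finite (bond_indices m (in_arcs G i))" for i
        unfolding bond_indices_def by (intro finite_PiE) (auto simp: in_arcs_def)
      \<comment> \<open>Meaningful entries are bounded by the isometry constraint, the others are 0.
        Hence the bound in \<open>S\<close> loses no state.\<close>
      then have "norm (B x) \<le> 1" for x
        unfolding B_def using isometric_norm_entry_le_1[OF A] by (cases x) auto
      moreover have "isometric G m d (curry_tensors B)"
        using A isometric_cong[of G d m "curry_tensors B" A] eq by simp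
      moreover have "?f B = \<psi>"
        unfolding \<psi> by (rule contraction_cong) (use verts_eq eq in auto)
      ultimately show "\<psi> \<in> ?f ` S"
        using norm by (auto simp: S_def)
    qed
  qed
  ultimately have "compactin (norm_topology N d) (MERA G N m d)"
    using image_compactin[OF _ continuous_map_contraction, of S N d G m] by simp
  \<comment> \<open>A metric topology is Hausdorff, so its compact sets are closed.\<close>
  then show ?thesis
    unfolding norm_topology_def
    by (intro compactin_imp_closedin Metric_space.Hausdorff_space_mtopology Metric_space_state)
qed

end
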